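(* Let $n \ge 3$ and let \[ A=(a_{ij})=\begin{pmatrix} B & b\\ b^T & a_{nn} \end{pmatrix} \] be a real symmetric $n\times n$ matrix, where $B$ is an $(n-1) \times (n-1)$ positive semidefinite matrix and $b=(b_1,\dots,b_{n-1})^T\in\mathbb{R}^{n-1}$. Assume that \[ \det(A) \le 0, \qquad a_{nn} \ge 0, \qquad \text{and} \qquad |b_i|\le \sqrt{a_{ii}a_{nn}}\quad \text{for } i=1,\dots,n-1. \] Then \[ \det(A)\ge -(n-1)\left(\frac{n-1}{n-2}\right)^{n-2}\,a_{11}\cdots a_{nn}. \] Moreover, the inequality is strict when $\det(A)\le 0$, $|b_i|\le \sqrt{a_{ii}a_{nn}}$ for $i=1,\dots,n-1$, $B$ is positive definite and $a_{nn} >0$.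
   Context: Here $a_{11},\dots,a_{nn}$ are the diagonal entries of $A$ (so $a_{11},\dots,a_{n-1,n-1}$ are the diagonal entries of $B$). *)

theory Defs
  imports Complex_Main "Jordan_Normal_Form.Determinant"
begin

(* Symmetry is part of both notions and also forces the matrix to be square. *)

definition positive_semidefinite :: "real mat \<Rightarrow> bool" where
  "positive_semidefinite M \<longleftrightarrow>
     M\<^sup>T = M \<and> (\<forall>x \<in> carrier_vec (dim_row M). x \<bullet> (M *\<^sub>v x) \<ge> 0)"

definition positive_definite :: "real mat \<Rightarrow> bool" where
  "positive_definite M \<longleftrightarrow>
     M\<^sup>T = M \<and> (\<forall>x \<in> carrier_vec (dim_row M). x \<noteq> 0\<^sub>v (dim_row M) \<longrightarrow> x \<bullet> (M *\<^sub>v x) > 0)"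

end

theory Submission
  imports Defs
begin

text \<open>
  Write \<open>A\<close> as \<open>B\<close> bordered by \<open>b\<close> with corner entry \<open>c\<close>, and let \<open>m = n - 1\<close>. If \<open>c = 0\<close>, then the
  bounds on \<open>b\<close> force \<open>b = 0\<close>, and both \<open>det A\<close> and the product of the diagonal vanish. Let \<open>c > 0\<close>.

  Consider the determinant as a function of the corner entry \<open>x\<close>. It is affine with slope \<open>det B\<close>
  (\<open>det_bordered_affine\<close>), and for \<open>x \<noteq> 0\<close> it equals \<open>x det (B - b b\<^sup>T / x)\<close>
  (\<open>det_bordered_schur\<close>). Comparing its values at \<open>x = c\<close> and \<open>x = - c / t\<close>, where \<open>t > 0\<close>, gives
  \<open>det A = (1 + 1 / t) c det B - (c / t) det P\<close> with \<open>P = B + (t / c) b b\<^sup>T\<close>.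
  Here \<open>P\<close> is positive semidefinite, and the assumption \<open>b\<^sub>i\<^sup>2 \<le> a\<^sub>i\<^sub>i c\<close> bounds its diagonal entries
  by \<open>(1 + t) a\<^sub>i\<^sub>i\<close>. Hadamard's inequality (\<open>det_positive_semidefinite_bounds\<close>) therefore yields
  \<open>det P \<le> (1 + t)\<^sup>m a\<^sub>1\<^sub>1 \<dots> a\<^sub>m\<^sub>m\<close>. The factor \<open>(1 + t)\<^sup>m / t\<close> is smallest at \<open>t = 1 / (m - 1)\<close>, where it
  equals \<open>m (m / (m - 1))\<^bsup>m - 1\<^esup>\<close>, the constant of the theorem.
  The remaining term \<open>m c det B\<close> is nonnegative, and positive if \<open>B\<close> is positive definite.
\<close>

section \<open>Bordered matrices and rank-one updates\<close>

text \<open>The square matrix with leading block \<open>B\<close>, last row and column \<open>b\<close> and corner entry \<open>c\<close>.\<close>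

definition bordered :: "real mat \<Rightarrow> real vec \<Rightarrow> real \<Rightarrow> real mat" where
  "bordered B b c = four_block_mat B (mat_of_cols (dim_vec b) [b]) (mat_of_row b) (mat 1 1 (\<lambda>_. c))"

text \<open>The matrix \<open>B + s b b\<^sup>T\<close>.\<close>

definition rank_one_update :: "real mat \<Rightarrow> real \<Rightarrow> real vec \<Rightarrow> real mat" where
  "rank_one_update B s b = mat (dim_row B) (dim_col B) (\<lambda>(i, j). B $$ (i, j) + s * b $ i * b $ j)"

lemma bordered_carrier [simp]:
  "B \<in> carrier_mat m m \<Longrightarrow> b \<in> carrier_vec m \<Longrightarrow> bordered B b c \<in> carrier_mat (Suc m) (Suc m)"
  by (auto simp: bordered_def four_block_mat_def Let_def)

lemma dim_bordered [simp]:
  "dim_row (bordered B b c) = Suc (dim_row B)" "dim_col (bordered B b c) = Suc (dim_col B)"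
  by (auto simp: bordered_def)

lemma rank_one_update_carrier [simp]:
  "B \<in> carrier_mat m m \<Longrightarrow> rank_one_update B s b \<in> carrier_mat m m"
  by (auto simp: rank_one_update_def)

lemma index_bordered:
  assumes "B \<in> carrier_mat m m" "b \<in> carrier_vec m" "i \<le> m" "j \<le> m"
  shows "bordered B b c $$ (i, j) =
    (if i < m then if j < m then B $$ (i, j) else b $ i
     else if j < m then b $ j else c)"
  using assms by (auto simp: bordered_def mat_of_cols_def mat_of_row_def)

lemma prod_diag_bordered:
  assumes "B \<in> carrier_mat m m" "b \<in> carrier_vec m"
  shows "(\<Prod>i<Suc m. bordered B b c $$ (i, i)) = (\<Prod>i<m. B $$ (i, i)) * c"
  using assms by (simp add: index_bordered)

lemma symmetric_eq_bordered:
  assumes M: "M \<in> carrier_mat (Suc m) (Suc m)" and sym: "M\<^sup>T = M"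
  obtains B b c where "B \<in> carrier_mat m m" "b \<in> carrier_vec m" "B\<^sup>T = B" "M = bordered B b c"
proof
  have sym': "M $$ (i, j) = M $$ (j, i)" if "i < Suc m" "j < Suc m" for i j
    using M that arg_cong[OF sym, of "\<lambda>X. X $$ (i, j)"] by simp
  show B: "mat m m (\<lambda>ij. M $$ ij) \<in> carrier_mat m m" by simp
  show b: "vec m (\<lambda>i. M $$ (i, m)) \<in> carrier_vec m" by simp
  show "(mat m m (\<lambda>ij. M $$ ij))\<^sup>T = mat m m (\<lambda>ij. M $$ ij)"
    by (rule eq_matI) (auto simp: sym')
  show "M = bordered (mat m m (\<lambda>ij. M $$ ij)) (vec m (\<lambda>i. M $$ (i, m))) (M $$ (m, m))"
  proof (rule eq_matI)
    fix i j
    assume "i < dim_row (bordered (mat m m (\<lambda>ij. M $$ ij)) (vec m (\<lambda>i. M $$ (i, m))) (M $$ (m, m)))"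
      and "j < dim_col (bordered (mat m m (\<lambda>ij. M $$ ij)) (vec m (\<lambda>i. M $$ (i, m))) (M $$ (m, m)))"
    then have ij: "i \<le> m" "j \<le> m" by auto
    then have "i < m \<or> i = m" "j < m \<or> j = m" by auto
    then show "M $$ (i, j) =
        bordered (mat m m (\<lambda>ij. M $$ ij)) (vec m (\<lambda>i. M $$ (i, m))) (M $$ (m, m)) $$ (i, j)"
      unfolding index_bordered[OF B b ij] by (auto simp: sym')
  qed (use M in auto)
qed

lemma bordered_quadratic_form:
  assumes B: "B \<in> carrier_mat m m" and b: "b \<in> carrier_vec m" and y: "y \<in> carrier_vec m"
  shows "(y @\<^sub>v vec 1 (\<lambda>_. z)) \<bullet> (bordered B b c *\<^sub>v (y @\<^sub>v vec 1 (\<lambda>_. z)))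
    = y \<bullet> (B *\<^sub>v y) + 2 * z * (b \<bullet> y) + c * z\<^sup>2"
proof -
  let ?z = "vec 1 (\<lambda>_. z) :: real vec"
  have dims: "mat_of_cols (dim_vec b) [b] \<in> carrier_mat m 1" "mat_of_row b \<in> carrier_mat 1 m"
    "mat 1 1 (\<lambda>_. c) \<in> carrier_mat 1 1" "?z \<in> carrier_vec 1"
    using b by auto
  have col: "mat_of_cols (dim_vec b) [b] *\<^sub>v ?z = z \<cdot>\<^sub>v b"
    using b by (intro eq_vecI) (auto simp: mat_of_cols_def scalar_prod_def)
  have row: "mat_of_row b *\<^sub>v y + mat 1 1 (\<lambda>_. c) *\<^sub>v ?z = vec 1 (\<lambda>_. b \<bullet> y + c * z)"
    by (intro eq_vecI) (auto simp: scalar_prod_def)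
  have By: "B *\<^sub>v y \<in> carrier_vec m" using B y by auto
  have "(y @\<^sub>v ?z) \<bullet> (bordered B b c *\<^sub>v (y @\<^sub>v ?z))
      = (y @\<^sub>v ?z) \<bullet> ((B *\<^sub>v y + z \<cdot>\<^sub>v b) @\<^sub>v vec 1 (\<lambda>_. b \<bullet> y + c * z))"
    unfolding bordered_def
    by (subst four_block_mat_mult_vec[OF B dims(1-3) y dims(4)]) (simp only: col row)
  also have "\<dots> = y \<bullet> (B *\<^sub>v y + z \<cdot>\<^sub>v b) + ?z \<bullet> vec 1 (\<lambda>_. b \<bullet> y + c * z)"
    by (rule scalar_prod_append) (use y b By in auto)
  also have "y \<bullet> (B *\<^sub>v y + z \<cdot>\<^sub>v b) = y \<bullet> (B *\<^sub>v y) + z * (b \<bullet> y)"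
    using y b By by (simp add: scalar_prod_add_distrib[of _ m] comm_scalar_prod[of y m b])
  finally show ?thesis by (simp add: scalar_prod_def algebra_simps power2_eq_square)
qed

lemma rank_one_update_quadratic_form:
  assumes B: "B \<in> carrier_mat m m" and b: "b \<in> carrier_vec m" and y: "y \<in> carrier_vec m"
  shows "y \<bullet> (rank_one_update B s b *\<^sub>v y) = y \<bullet> (B *\<^sub>v y) + s * (b \<bullet> y)\<^sup>2"
proof -
  have "rank_one_update B s b *\<^sub>v y = B *\<^sub>v y + (s * (b \<bullet> y)) \<cdot>\<^sub>v b"
    using B b y by (intro eq_vecI)
      (auto simp: rank_one_update_def scalar_prod_def algebra_simps sum.distrib sum_distrib_left)
  moreover have "B *\<^sub>v y \<in> carrier_vec m" using B y by auto
  ultimately show ?thesis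
    using y b by (simp add: scalar_prod_add_distrib[of _ m] comm_scalar_prod[of y m b] power2_eq_square)
qed

lemma symmetric_rank_one_update:
  assumes B: "B \<in> carrier_mat m m" and sym: "B\<^sup>T = B"
  shows "(rank_one_update B s b)\<^sup>T = rank_one_update B s b"
proof (rule eq_matI)
  fix i j assume "i < dim_row (rank_one_update B s b)" "j < dim_col (rank_one_update B s b)"
  then have ij: "i < m" "j < m" using B by (auto simp: rank_one_update_def)
  then have "B $$ (i, j) = B $$ (j, i)"
    using B arg_cong[OF sym, of "\<lambda>X. X $$ (i, j)"] by simp
  then show "(rank_one_update B s b)\<^sup>T $$ (i, j) = rank_one_update B s b $$ (i, j)"
    using B ij by (simp add: rank_one_update_def)
qed (use B in \<open>auto simp: rank_one_update_def\<close>)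

section \<open>The determinant of a bordered matrix\<close>

lemma det_bordered_affine:
  assumes B: "B \<in> carrier_mat m m" and b: "b \<in> carrier_vec m"
  obtains k where "\<And>x. Determinant.det (bordered B b x) = x * Determinant.det B + k"
proof
  fix x
  have del: "mat_delete (bordered B b x) i m = mat_delete (bordered B b 0) i m" if "i < Suc m" for i
    using B b that
    by (intro eq_matI) (auto simp: mat_delete_def bordered_def mat_of_cols_def mat_of_row_def)
  have corner: "mat_delete (bordered B b x) m m = B"
    using B b by (intro eq_matI) (auto simp: mat_delete_def bordered_def)
  have "Determinant.det (bordered B b x)
      = (\<Sum>i<Suc m. bordered B b x $$ (i, m) * cofactor (bordered B b x) i m)"
    by (rule laplace_expansion_column) (use B b in auto)
  also have "\<dots> = x * Determinant.det B
      + (\<Sum>i<m. bordered B b x $$ (i, m) * cofactor (bordered B b x) i m)"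
    using B b by (simp add: index_bordered cofactor_def corner)
  also have "(\<Sum>i<m. bordered B b x $$ (i, m) * cofactor (bordered B b x) i m)
      = (\<Sum>i<m. b $ i * cofactor (bordered B b 0) i m)"
    using B b by (intro sum.cong) (auto simp: index_bordered cofactor_def del)
  finally show "Determinant.det (bordered B b x)
      = x * Determinant.det B + (\<Sum>i<m. b $ i * cofactor (bordered B b 0) i m)" .
qed

lemma det_bordered_schur:
  assumes B: "B \<in> carrier_mat m m" and b: "b \<in> carrier_vec m" and x: "x \<noteq> 0"
  shows "Determinant.det (bordered B b x) = x * Determinant.det (rank_one_update B (- 1 / x) b)"
proof -
  let ?col = "mat_of_cols (dim_vec b) [b]" and ?row = "mat_of_row b"
    and ?x = "mat 1 1 (\<lambda>_. x) :: real mat"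
  let ?L = "four_block_mat (1\<^sub>m m) (0\<^sub>m m 1) ((- 1 / x) \<cdot>\<^sub>m ?row) (1\<^sub>m 1)"
  have dims: "?col \<in> carrier_mat m 1" "?row \<in> carrier_mat 1 m" "?x \<in> carrier_mat 1 1"
    using b by auto
  have L: "?L \<in> carrier_mat (Suc m) (Suc m)" using b by auto
  have schur: "B * 1\<^sub>m m + ?col * ((- 1 / x) \<cdot>\<^sub>m ?row) = rank_one_update B (- 1 / x) b"
    using B b by (intro eq_matI) (auto simp: rank_one_update_def mat_of_cols_def scalar_prod_def)
  have zero: "?row * 1\<^sub>m m + ?x * ((- 1 / x) \<cdot>\<^sub>m ?row) = 0\<^sub>m 1 m"
    using b x by (intro eq_matI) (auto simp: scalar_prod_def)
  have "bordered B b x * ?L = four_block_mat (rank_one_update B (- 1 / x) b) ?col (0\<^sub>m 1 m) ?x"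
    unfolding bordered_def
    by (subst mult_four_block_mat[of _ m m _ 1 _ 1 _ _ m _ 1])
       (use B b dims in \<open>simp_all only: schur zero, auto\<close>)
  then have "Determinant.det (bordered B b x) * Determinant.det ?L
      = Determinant.det (rank_one_update B (- 1 / x) b) * Determinant.det ?x"
    using det_mult[OF bordered_carrier[OF B b] L] det_four_block_mat_lower_left_zero
      [OF rank_one_update_carrier[OF B] dims(1) refl dims(3)] by metis
  moreover have "Determinant.det ?L = 1"
    by (subst det_four_block_mat_upper_right_zero[of _ m _ 1]) (use b in auto)
  moreover have "Determinant.det ?x = x"
    by (simp add: det_single)
  ultimately show ?thesis by simp
qed

lemma det_bordered_zero_border:
  assumes B: "B \<in> carrier_mat m m"
  shows "Determinant.det (bordered B (0\<^sub>v m) x) = x * Determinant.det B"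
proof -
  have "mat_of_row (0\<^sub>v m) = (0\<^sub>m 1 m :: real mat)" by (intro eq_matI) (auto simp: mat_of_row_def)
  then have "Determinant.det (bordered B (0\<^sub>v m) x) = Determinant.det B * Determinant.det (mat 1 1 (\<lambda>_. x))"
    unfolding bordered_def by (intro det_four_block_mat_lower_left_zero[OF B]) auto
  then show ?thesis by (simp add: det_single)
qed

section \<open>Hadamard's inequality\<close>

lemma positive_semidefinite_borderedD:
  assumes B: "B \<in> carrier_mat m m" and b: "b \<in> carrier_vec m"
    and psd: "positive_semidefinite (bordered B b c)" and y: "y \<in> carrier_vec m"
  shows "0 \<le> y \<bullet> (B *\<^sub>v y) + 2 * z * (b \<bullet> y) + c * z\<^sup>2"
proof -
  have "dim_row (bordered B b c) = Suc m" using B by simp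
  moreover have "y @\<^sub>v vec 1 (\<lambda>_. z) \<in> carrier_vec (Suc m)" using y by (intro carrier_vecI) simp
  ultimately show ?thesis
    using psd unfolding positive_semidefinite_def bordered_quadratic_form[OF B b y, symmetric]
    by metis
qed

lemma positive_semidefinite_rank_one_update:
  assumes B: "B \<in> carrier_mat m m" and b: "b \<in> carrier_vec m"
    and psd: "positive_semidefinite B" and s: "0 \<le> s"
  shows "positive_semidefinite (rank_one_update B s b)"
proof -
  have "0 \<le> x \<bullet> (rank_one_update B s b *\<^sub>v x)" if "x \<in> carrier_vec m" for x
    using psd that B s
    by (auto simp: rank_one_update_quadratic_form[OF B b that] positive_semidefinite_def)
  then show ?thesis
    using psd symmetric_rank_one_update[OF B] rank_one_update_carrier[OF B, of s b]
    by (auto simp: positive_semidefinite_def)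
qed

text \<open>Determinants of positive semidefinite matrices are nonnegative and satisfy Hadamard's
  inequality. If the corner entry \<open>c\<close> is positive, then \<open>det M = c det S\<close> for the Schur complement
  \<open>S = B - b b\<^sup>T / c\<close>, which is again positive semidefinite and whose diagonal entries do not exceed
  those of \<open>B\<close>.
  If \<open>c = 0\<close>, then the whole last row vanishes.\<close>

lemma det_positive_semidefinite_bounds:
  assumes "M \<in> carrier_mat m m" and "positive_semidefinite M"
  shows "(\<forall>i<m. 0 \<le> M $$ (i, i)) \<and> 0 \<le> Determinant.det M
    \<and> Determinant.det M \<le> (\<Prod>i<m. M $$ (i, i))"
  using assms
proof (induction m arbitrary: M)
  case 0
  then show ?case by simp
next
  case (Suc m)
  from Suc.prems(2) have "M\<^sup>T = M" by (simp add: positive_semidefinite_def)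
  with Suc.prems(1) obtain B b c where B: "B \<in> carrier_mat m m" and b: "b \<in> carrier_vec m"
    and B_sym: "B\<^sup>T = B" and M: "M = bordered B b c"
    by (rule symmetric_eq_bordered)
  note psd = positive_semidefinite_borderedD[OF B b Suc.prems(2)[unfolded M]]
  have B_psd: "positive_semidefinite B"
    using B B_sym psd[where z = 0] by (auto simp: positive_semidefinite_def)
  note IH_B = Suc.IH[OF B B_psd]
  have c: "0 \<le> c" using psd[of "0\<^sub>v m" 1] B b by simp
  have diag: "\<forall>i<Suc m. 0 \<le> M $$ (i, i)"
    using IH_B c B b by (auto simp: M index_bordered less_Suc_eq)
  show ?case
  proof (cases "c = 0")
    case True
    have "b \<bullet> b = 0"
    proof (rule ccontr)
      assume nz: "b \<bullet> b \<noteq> 0"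
      \<comment> \<open>The form is affine in the last coordinate; this value makes it equal to \<open>-1\<close>.\<close>
      let ?z = "- (b \<bullet> (B *\<^sub>v b) + 1) / (2 * (b \<bullet> b))"
      have "2 * ?z * (b \<bullet> b) = - (b \<bullet> (B *\<^sub>v b) + 1)" using nz by simp
      then show False using psd[OF b, of ?z] unfolding True by simp
    qed
    then have "b = 0\<^sub>v m"
      using conjugate_square_eq_0_vec[OF b] by simp
    then have "Determinant.det M = 0"
      using det_bordered_zero_border[OF B] True M by simp
    moreover have "(\<Prod>i<Suc m. M $$ (i, i)) = 0"
      using prod_diag_bordered[OF B b] M True by simp
    ultimately show ?thesis using diag by (metis order.refl)
  next
    case False
    with c have c: "0 < c" by simp
    let ?S = "rank_one_update B (- 1 / c) b"
    have S: "?S \<in> carrier_mat m m" using B by simp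
    have "0 \<le> y \<bullet> (?S *\<^sub>v y)" if y: "y \<in> carrier_vec m" for y
      \<comment> \<open>This last coordinate minimises the form of \<open>M\<close>; the minimum is the form of the Schur
        complement.\<close>
      using psd[OF y, of "- (b \<bullet> y) / c"] c
      by (simp add: rank_one_update_quadratic_form[OF B b y] power2_eq_square field_simps)
    then have S_psd: "positive_semidefinite ?S"
      using S symmetric_rank_one_update[OF B B_sym] by (auto simp: positive_semidefinite_def)
    note IH = Suc.IH[OF S S_psd]
    have "(\<Prod>i<m. ?S $$ (i, i)) \<le> (\<Prod>i<m. B $$ (i, i))"
      using IH B c by (intro prod_mono) (auto simp: rank_one_update_def)
    then have "Determinant.det ?S \<le> (\<Prod>i<m. B $$ (i, i))" using IH by linarith
    then show ?thesis
      using diag IH c prod_diag_bordered[OF B b, of c] det_bordered_schur[OF B b, of c]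
      by (auto simp: M mult.commute)
  qed
qed

lemma positive_definite_imp_semidefinite:
  assumes "positive_definite B"
  shows "positive_semidefinite B"
proof -
  have "0 \<le> x \<bullet> (B *\<^sub>v x)" if "x \<in> carrier_vec (dim_row B)" for x
  proof (cases "x = 0\<^sub>v (dim_row B)")
    case True
    then have "x \<bullet> (B *\<^sub>v x) = 0"
      by (metis scalar_prod_left_zero carrier_vecI dim_mult_mat_vec)
    then show ?thesis by simp
  next
    case False
    with assms that show ?thesis by (auto simp: positive_definite_def intro: less_imp_le)
  qed
  with assms show ?thesis by (auto simp: positive_definite_def positive_semidefinite_def)
qed

lemma det_positive_definite:
  assumes B: "B \<in> carrier_mat m m" and pd: "positive_definite B"
  shows "0 < Determinant.det B"
proof -
  have "Determinant.det B \<noteq> 0"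
  proof
    assume "Determinant.det B = 0"
    then obtain v where v: "v \<in> carrier_vec m" "v \<noteq> 0\<^sub>v m" "B *\<^sub>v v = 0\<^sub>v m"
      using det_0_iff_vec_prod_zero[OF B] by blast
    then have "0 < v \<bullet> (B *\<^sub>v v)" using pd B unfolding positive_definite_def by auto
    with v show False by simp
  qed
  moreover have "0 \<le> Determinant.det B"
    using det_positive_semidefinite_bounds[OF B positive_definite_imp_semidefinite[OF pd]] by simp
  ultimately show ?thesis by simp
qed

section \<open>The lower bound\<close>

text \<open>Sharper form of the bound for \<open>c > 0\<close>, which keeps the term in \<open>det B\<close> that makes the
  inequality strict when \<open>B\<close> is positive definite.\<close>

lemma det_bordered_lower_bound:
  assumes B: "B \<in> carrier_mat m m" and b: "b \<in> carrier_vec m" and psd: "positive_semidefinite B"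
    and c: "0 < c" and m: "2 \<le> m"
    and b_le: "\<And>i. i < m \<Longrightarrow> (b $ i)\<^sup>2 \<le> B $$ (i, i) * c"
  shows "real m * c * Determinant.det B
      - real m * (real m / (real m - 1)) ^ (m - 1) * ((\<Prod>i<m. B $$ (i, i)) * c)
    \<le> Determinant.det (bordered B b c)"
proof -
  define t where "t = 1 / (real m - 1)"
  have t: "0 < t" using m by (simp add: t_def)
  let ?P = "rank_one_update B (t / c) b"
  have P: "?P \<in> carrier_mat m m" using B by simp
  have P_psd: "positive_semidefinite ?P"
    using positive_semidefinite_rank_one_update[OF B b psd] t c by simp
  have diag: "?P $$ (i, i) \<le> (1 + t) * B $$ (i, i)" if "i < m" for i
  proof -
    have "t / c * (b $ i)\<^sup>2 \<le> t / c * (B $$ (i, i) * c)"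
      using b_le[OF that] t c by (intro mult_left_mono) auto
    then show ?thesis using B that c by (simp add: rank_one_update_def power2_eq_square algebra_simps)
  qed
  have "Determinant.det ?P \<le> (\<Prod>i<m. ?P $$ (i, i))"
    using det_positive_semidefinite_bounds[OF P P_psd] by simp
  also have "\<dots> \<le> (\<Prod>i<m. (1 + t) * B $$ (i, i))"
    using det_positive_semidefinite_bounds[OF P P_psd] diag by (intro prod_mono) auto
  also have "\<dots> = (1 + t) ^ m * (\<Prod>i<m. B $$ (i, i))" by (simp add: prod.distrib)
  finally have P_le: "Determinant.det ?P \<le> (1 + t) ^ m * (\<Prod>i<m. B $$ (i, i))" .
  obtain k where k: "\<And>x. Determinant.det (bordered B b x) = x * Determinant.det B + k"
    using det_bordered_affine[OF B b] by blast
  \<comment> \<open>The corner entry \<open>- c / t\<close> turns the Schur complement into the positive semidefinite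
    matrix \<open>B + (t / c) b b\<^sup>T\<close>.\<close>
  have "Determinant.det (bordered B b (- (c / t))) = - (c / t) * Determinant.det ?P"
    using det_bordered_schur[OF B b, of "- (c / t)"] c t by simp
  with k[of "- (c / t)"] k[of c]
  have eq: "Determinant.det (bordered B b c)
      = (1 + 1 / t) * c * Determinant.det B - c / t * Determinant.det ?P"
    by (simp add: algebra_simps)
  have t1: "1 + 1 / t = real m" "1 / t = real m - 1" using m by (auto simp: t_def)
  have t2: "1 + t = real m / (real m - 1)" using m by (simp add: t_def field_simps)
  have pow: "1 / t * (1 + t) ^ m = real m * (real m / (real m - 1)) ^ (m - 1)"
    unfolding t1(2) t2 using m by (cases m) auto
  have "c / t * Determinant.det ?P \<le> c / t * ((1 + t) ^ m * (\<Prod>i<m. B $$ (i, i)))"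
    using P_le c t by (intro mult_left_mono) auto
  also have "\<dots> = 1 / t * (1 + t) ^ m * ((\<Prod>i<m. B $$ (i, i)) * c)" by simp
  finally show ?thesis unfolding eq pow t1(1) by linarith
qed

theorem theorem1p4:
  fixes n :: nat and A B :: "real mat" and b :: "real vec"
  assumes n: "n \<ge> 3"
    and A: "A \<in> carrier_mat n n"
    and A_sym: "A\<^sup>T = A"
    and B: "B \<in> carrier_mat (n - 1) (n - 1)"
    and b: "b \<in> carrier_vec (n - 1)"
    and A_block: "A = four_block_mat B (mat_of_cols (n - 1) [b])
                        (mat_of_row b) (mat 1 1 (\<lambda>_. A $$ (n - 1, n - 1)))"
    and B_psd: "positive_semidefinite B"
    and det_A: "Determinant.det A \<le> 0"
    and ann: "A $$ (n - 1, n - 1) \<ge> 0"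
    and b_le: "\<And>i. i < n - 1 \<Longrightarrow> \<bar>b $ i\<bar> \<le> sqrt (A $$ (i, i) * A $$ (n - 1, n - 1))"
  shows "Determinant.det A
           \<ge> - (real n - 1) * ((real n - 1) / (real n - 2)) ^ (n - 2) * (\<Prod>i<n. A $$ (i, i))
       \<and> (positive_definite B \<and> A $$ (n - 1, n - 1) > 0 \<longrightarrow>
           Determinant.det A
             > - (real n - 1) * ((real n - 1) / (real n - 2)) ^ (n - 2) * (\<Prod>i<n. A $$ (i, i)))"
proof -
  define m where "m = n - 1"
  define c where "c = A $$ (n - 1, n - 1)"
  have m: "2 \<le> m" "n = Suc m" "n - 1 = m" "n - 2 = m - 1"
    "real n - 1 = real m" "real n - 2 = real m - 1"
    using n by (auto simp: m_def)
  have B: "B \<in> carrier_mat m m" and b: "b \<in> carrier_vec m" using B b by (auto simp: m_def)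
  have A_eq: "A = bordered B b c"
    using A_block b unfolding bordered_def c_def m_def by auto
  have prod: "(\<Prod>i<n. A $$ (i, i)) = (\<Prod>i<m. B $$ (i, i)) * c"
    using prod_diag_bordered[OF B b] by (simp add: A_eq m(2))
  have diag: "0 \<le> B $$ (i, i)" if "i < m" for i
    using det_positive_semidefinite_bounds[OF B B_psd] that by simp
  have c: "0 \<le> c" using ann by (simp add: c_def)
  have b_sq: "(b $ i)\<^sup>2 \<le> B $$ (i, i) * c" if i: "i < m" for i
  proof -
    have "\<bar>b $ i\<bar> \<le> sqrt (B $$ (i, i) * c)"
      using b_le[of i] i B b unfolding m(3) c_def by (simp add: A_eq index_bordered)
    then show ?thesis using real_le_rsqrt diag[OF i] c
      by (metis abs_ge_zero mult_nonneg_nonneg power2_abs power_mono real_sqrt_pow2)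
  qed
  show ?thesis
  proof (cases "c = 0")
    case True
    then have "b $ i = 0" if "i < m" for i using b_sq[OF that] by simp
    then have "b = 0\<^sub>v m" using b by (intro eq_vecI) auto
    then have "Determinant.det A = 0" using det_bordered_zero_border[OF B] True A_eq by simp
    then show ?thesis unfolding prod c_def[symmetric] using True by simp
  next
    case False
    with c have c: "0 < c" by simp
    have bound: "real m * c * Determinant.det B
        - real m * (real m / (real m - 1)) ^ (m - 1) * ((\<Prod>i<m. B $$ (i, i)) * c)
      \<le> Determinant.det A"
      unfolding A_eq by (rule det_bordered_lower_bound[OF B b B_psd c m(1) b_sq])
    have nonneg: "0 \<le> real m * c * Determinant.det B"
      using det_positive_semidefinite_bounds[OF B B_psd] c by simp
    have pos: "0 < real m * c * Determinant.det B" if "positive_definite B"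
      using det_positive_definite[OF B that] c m(1) by simp
    show ?thesis
      using bound nonneg pos unfolding prod m(4-6) by fastforce
  qed
qed

end
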